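(* Let $G$ be any graph with $n$ vertices. Then the expected characteristic polynomial $\mathbb{E}(\det(xI-S))$, over the uniform distribution on the Seidel matrices $S$ of $G$, is \[\sum_{k=0}^{\lfloor n/2\rfloor} m_k\,x^{n-2k},\] where $m_k$ is the number of matchings of $G$ having exactly $k$ edges.
   Context: For a (simple) graph $G$ on vertices $1,\dots,n$, a Seidel matrix of $G$ is an $n\times n$ skew-symmetric matrix $S=[s_{ij}]$ with $s_{ij}\in\{\pm1\}$ if $ij$ is an edge of $G$ and $s_{ij}=0$ otherwise (these correspond to orientations of $G$); the uniform distribution gives each of the $2^{|E(G)|}$ such matrices equal probability. A matching is a set of pairwise vertex-disjoint edges; $m_0=1$. *)

theory Defs
  imports
    "HOL-Probability.Probability_Mass_Function"
    "HOL-Library.Disjoint_Sets"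
    "Jordan_Normal_Form.Char_Poly"
begin

text \<open>Graphs have vertex set \<open>{..<n}\<close> rather than \<open>{1..n}\<close>, so that vertices are the
  row and column indices of matrices, which start at 0. An edge is a set of two vertices.\<close>

definition simple_graph :: "nat \<Rightarrow> nat set set \<Rightarrow> bool" where
  "simple_graph n E \<longleftrightarrow> (\<forall>e\<in>E. e \<subseteq> {..<n} \<and> card e = 2)"

definition seidel_matrices :: "nat \<Rightarrow> nat set set \<Rightarrow> real mat set" where
  "seidel_matrices n E = {S \<in> carrier_mat n n. S\<^sup>T = - S \<and>
     (\<forall>i<n. \<forall>j<n. if {i, j} \<in> E then S $$ (i, j) \<in> {1, -1} else S $$ (i, j) = 0)}"

definition matchings :: "nat set set \<Rightarrow> nat \<Rightarrow> nat set set set" where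
  "matchings E k = {M. M \<subseteq> E \<and> disjoint M \<and> card M = k}"

text \<open>The library's \<open>measure_pmf.expectation\<close> needs values in a Banach space, which
  \<open>real poly\<close> is not. For finitely supported \<open>p\<close> the expectation of a polynomial-valued
  random variable is the following finite sum; the two lemmas after it relate it to
  the library's notion. For infinite support the sum is 0 by convention.\<close>

definition poly_expectation :: "'a pmf \<Rightarrow> ('a \<Rightarrow> real poly) \<Rightarrow> real poly" where
  "poly_expectation p X = (\<Sum>\<omega>\<in>set_pmf p. Polynomial.smult (pmf p \<omega>) (X \<omega>))"

lemma poly_poly_expectation:
  assumes "finite (set_pmf p)"
  shows "poly (poly_expectation p X) x = measure_pmf.expectation p (\<lambda>\<omega>. poly (X \<omega>) x)"
  using assms unfolding poly_expectation_def
  by (subst integral_measure_pmf[of "set_pmf p"]) (auto simp: poly_sum)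

lemma coeff_poly_expectation:
  assumes "finite (set_pmf p)"
  shows "coeff (poly_expectation p X) i = measure_pmf.expectation p (\<lambda>\<omega>. coeff (X \<omega>) i)"
  using assms unfolding poly_expectation_def
  by (subst integral_measure_pmf[of "set_pmf p"]) (auto simp: coeff_sum)

text \<open>\<open>pmf_of_set\<close> is the uniform distribution only for finite nonempty sets.\<close>

lemma finite_seidel_matrices: "finite (seidel_matrices n E)"
proof -
  let ?F = "({..<n} \<times> {..<n}) \<rightarrow>\<^sub>E {0, 1, -1::real}"
  have "seidel_matrices n E \<subseteq> (\<lambda>f. mat n n f) ` ?F"
  proof
    fix S assume S: "S \<in> seidel_matrices n E"
    let ?f = "restrict (\<lambda>p. S $$ p) ({..<n} \<times> {..<n})"
    have "S \<in> carrier_mat n n"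
      using S by (simp add: seidel_matrices_def)
    then have "S = mat n n ?f"
      by (intro eq_matI) auto
    moreover have "S $$ (i, j) \<in> {0, 1, -1}" if "i < n" "j < n" for i j
      using S that by (auto simp: seidel_matrices_def split: if_splits)
    then have "?f \<in> ?F"
      by (auto simp: PiE_iff)
    ultimately show "S \<in> (\<lambda>f. mat n n f) ` ?F"
      by blast
  qed
  moreover have "finite ?F"
    by (intro finite_PiE) auto
  ultimately show ?thesis
    by (meson finite_imageI finite_subset)
qed

lemma seidel_matrices_nonempty:
  assumes "simple_graph n E"
  shows "seidel_matrices n E \<noteq> {}"
proof -
  let ?S = "mat n n (\<lambda>(i, j). if {i, j} \<in> E then if i < j then 1 else -1 else (0::real))"
  have "{i} \<notin> E" for i
    using assms by (auto simp: simple_graph_def)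
  then have "?S\<^sup>T = - ?S"
    by (intro eq_matI) (auto simp: insert_commute)
  then have "?S \<in> seidel_matrices n E"
    by (auto simp: seidel_matrices_def)
  then show ?thesis
    by blast
qed

end

theory Submission
  imports Defs
begin

text \<open>Expand \<open>det (xI - S)\<close> over permutations \<open>p\<close> and average each term over \<open>S\<close>.
  If \<open>p (p a) \<noteq> a\<close> for some \<open>a\<close>, the entry \<open>S $$ (a, p a)\<close> occurs in the term but its
  mirror image does not, so flipping the orientation of the edge \<open>{a, p a}\<close> negates the term and
  its average is 0. The remaining \<open>p\<close> are involutions; those moving points along edges only
  correspond to matchings, and the others contribute 0. For a matching with \<open>k\<close> edges, each edge
  contributes \<open>S $$ (a, b) * S $$ (b, a) = -1\<close>, which cancels the sign \<open>(-1) ^ k\<close> of the involution,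
  and each of the \<open>n - 2 * k\<close> fixed points contributes \<open>x\<close>.\<close>

section \<open>Matchings as involutions\<close>

text \<open>The map that swaps the two ends of each edge of a matching. Unmatched points are fixed,
  so that it can be a permutation in the sense of \<open>permutes\<close>. The \<open>THE\<close>
  relies on \<open>M\<close> being a disjoint family of pairs.\<close>

definition partner :: "'a set set \<Rightarrow> 'a \<Rightarrow> 'a" where
  "partner M i = (if i \<in> \<Union>M then THE j. {i, j} \<in> M else i)"

text \<open>Meant as the inverse of \<open>partner\<close>: for an involution these are its
  2-cycles, each occurring once because \<open>{i, p i}\<close> is unordered.\<close>

definition moved_pairs :: "('a \<Rightarrow> 'a) \<Rightarrow> 'a set set" where
  "moved_pairs p = {{i, p i} | i. p i \<noteq> i}"

definition edge_involutions :: "nat \<Rightarrow> nat set set \<Rightarrow> (nat \<Rightarrow> nat) set" where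
  "edge_involutions n E =
     {p. p permutes {..<n} \<and> (\<forall>i. p (p i) = i) \<and> (\<forall>i. p i \<noteq> i \<longrightarrow> {i, p i} \<in> E)}"

text \<open>Two members of \<open>M\<close> that share \<open>i\<close> coincide by disjointness, so
  \<open>THE\<close> has a single candidate.\<close>

lemma partner_eq:
  assumes "disjoint M" "{i, j} \<in> M"
  shows "partner M i = j"
proof -
  have unique: "k = j" if "{i, k} \<in> M" for k
  proof -
    have "{i, k} = {i, j}"
      using disjointD[OF assms(1) that assms(2)] by auto
    then show ?thesis
      by (auto simp: doubleton_eq_iff)
  qed
  have "(THE j. {i, j} \<in> M) = j"
    by (rule the_equality) (fact assms(2), erule unique)
  then show ?thesis
    using assms(2) by (auto simp: partner_def)
qed

lemma partner_outside: "i \<notin> \<Union>M \<Longrightarrow> partner M i = i"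
  by (simp add: partner_def)

lemma in_matching_cases:
  assumes "\<forall>e\<in>M. card e = 2" "i \<in> \<Union>M"
  obtains j where "{i, j} \<in> M" "j \<noteq> i"
proof -
  obtain e where e: "e \<in> M" "i \<in> e" "card e = 2"
    using assms by blast
  then obtain a b where "e = {a, b}" "a \<noteq> b"
    by (auto simp: card_2_iff)
  with e that show ?thesis
    by (metis insert_commute insertE singletonD)
qed

lemma partner_involution:
  assumes "disjoint M" "\<forall>e\<in>M. card e = 2"
  shows "partner M (partner M i) = i"
proof (cases "i \<in> \<Union>M")
  case True
  then obtain j where "{i, j} \<in> M"
    using assms by (meson in_matching_cases)
  then show ?thesis
    using assms(1) by (metis insert_commute partner_eq)
qed (simp add: partner_outside)

lemma partner_edge:
  assumes "disjoint M" "\<forall>e\<in>M. card e = 2" "partner M i \<noteq> i"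
  shows "{i, partner M i} \<in> M"
proof -
  have "i \<in> \<Union>M"
    using assms(3) partner_outside by metis
  then show ?thesis
    using assms by (metis in_matching_cases partner_eq)
qed

lemma partner_permutes:
  assumes "disjoint M" "\<forall>e\<in>M. card e = 2" "\<Union>M \<subseteq> A"
  shows "partner M permutes A"
proof -
  have "\<exists>!x. partner M x = y" for y
    using partner_involution[OF assms(1,2)] by metis
  moreover have "partner M x = x" if "x \<notin> A" for x
    using that assms(3) by (intro partner_outside) blast
  ultimately show ?thesis
    by (simp add: permutes_def)
qed

text \<open>Disjointness keeps \<open>a\<close> and \<open>b\<close> outside
  \<open>\<Union>M\<close>, so the transposition and \<open>partner M\<close> move different points.
  This is the induction step for the sign.\<close>

lemma partner_insert:
  assumes "disjoint (insert {a, b} M)" "{a, b} \<notin> M" "\<forall>e\<in>M. card e = 2"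
  shows "partner (insert {a, b} M) = Transposition.transpose a b \<circ> partner M"
proof
  fix i
  have M: "disjoint M"
    using assms(1) by (auto simp: disjoint_def)
  have ab: "a \<notin> \<Union>M" "b \<notin> \<Union>M"
    using assms(1,2) by (auto simp: disjoint_def)
  consider "i = a" | "i = b" | "i \<in> \<Union>M" | "i \<noteq> a" "i \<noteq> b" "i \<notin> \<Union>M"
    by blast
  then show "partner (insert {a, b} M) i = (Transposition.transpose a b \<circ> partner M) i"
  proof cases
    case 1
    then show ?thesis
      using ab assms(1) by (simp add: partner_outside partner_eq)
  next
    case 2
    then show ?thesis
      using ab assms(1) by (simp add: partner_outside partner_eq insert_commute)
  next
    case 3
    then obtain j where j: "{i, j} \<in> M"
      using assms(3) by (meson in_matching_cases)
    then have "j \<in> \<Union>M"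
      by blast
    then have "j \<noteq> a" "j \<noteq> b"
      using ab by blast+
    then show ?thesis
      using j M assms(1) by (simp add: partner_eq)
  next
    case 4
    then show ?thesis
      by (simp add: partner_outside)
  qed
qed

lemma sign_partner:
  assumes "finite M" "disjoint M" "\<forall>e\<in>M. card e = 2"
  shows "sign (partner M) = (-1) ^ card M"
  using assms
proof (induction M rule: finite_induct)
  case empty
  have "partner {} = (id :: 'a \<Rightarrow> 'a)"
    by (auto simp: partner_def)
  then show ?case
    by simp
next
  case (insert e M)
  obtain a b where e: "e = {a, b}" "a \<noteq> b"
    using insert.prems by (auto simp: card_2_iff)
  have M: "disjoint M" "\<forall>e\<in>M. card e = 2"
    using insert.prems by (auto simp: disjoint_def)
  \<comment> \<open>Multiplicativity of \<open>sign\<close> is available for permutations that move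
    finitely many points.\<close>
  have "finite (\<Union>M)"
    using insert.hyps M(2) by (intro finite_Union) (auto intro!: card_ge_0_finite)
  then have "permutation (partner M)"
    using partner_permutes[OF M order_refl] by (auto simp: permutation_permutes)
  moreover have "partner (insert e M) = Transposition.transpose a b \<circ> partner M"
    using insert.prems insert.hyps M unfolding e by (intro partner_insert) auto
  ultimately show ?case
    using insert.IH[OF M] insert.hyps e
    by (simp add: sign_compose permutation_swap_id sign_swap_id del: o_apply comp_apply)
qed

lemma moved_pairs_partner:
  assumes "disjoint M" "\<forall>e\<in>M. card e = 2"
  shows "moved_pairs (partner M) = M"
proof (intro equalityI subsetI)
  fix e assume "e \<in> moved_pairs (partner M)"
  then show "e \<in> M"
    using partner_edge[OF assms] by (auto simp: moved_pairs_def)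
next
  fix e assume e: "e \<in> M"
  then obtain a b where "e = {a, b}" "a \<noteq> b"
    using assms(2) by (auto simp: card_2_iff)
  with e show "e \<in> moved_pairs (partner M)"
    using partner_eq[OF assms(1), of a b] by (auto simp: moved_pairs_def)
qed

lemma disjoint_moved_pairs:
  assumes "\<And>i. p (p i) = i"
  shows "disjoint (moved_pairs p)"
proof -
  \<comment> \<open>By injectivity, pairs \<open>{i, p i}\<close> and \<open>{j, p j}\<close> with a
    common point are equal.\<close>
  have "p i = p j \<Longrightarrow> i = j" for i j
    using assms by metis
  then show ?thesis
    using assms by (auto simp: disjoint_def moved_pairs_def)
qed

lemma partner_moved_pairs:
  assumes "\<And>i. p (p i) = i"
  shows "partner (moved_pairs p) = p"
proof
  fix i
  show "partner (moved_pairs p) i = p i"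
  proof (cases "p i = i")
    case True
    then have "i \<notin> \<Union>(moved_pairs p)"
      using assms by (auto simp: moved_pairs_def)
    with True show ?thesis
      by (simp add: partner_outside)
  next
    case False
    then have "{i, p i} \<in> moved_pairs p"
      by (auto simp: moved_pairs_def)
    then show ?thesis
      using assms by (intro partner_eq disjoint_moved_pairs)
  qed
qed

text \<open>\<open>partner\<close> and \<open>moved_pairs\<close> are mutually inverse here; this
  turns the sum over the surviving permutations into a sum over matchings.\<close>

lemma bij_betw_partner:
  assumes "simple_graph n E"
  shows "bij_betw partner {M. M \<subseteq> E \<and> disjoint M} (edge_involutions n E)"
proof (rule bij_betw_byWitness[where f' = moved_pairs])
  have E: "\<forall>e\<in>M. card e = 2" "\<Union>M \<subseteq> {..<n}" if "M \<subseteq> E" for M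
    using assms that by (auto simp: simple_graph_def)
  show "\<forall>M\<in>{M. M \<subseteq> E \<and> disjoint M}. moved_pairs (partner M) = M"
    using E by (auto simp: moved_pairs_partner)
  show "\<forall>p\<in>edge_involutions n E. partner (moved_pairs p) = p"
    by (auto simp: edge_involutions_def partner_moved_pairs)
  show "partner ` {M. M \<subseteq> E \<and> disjoint M} \<subseteq> edge_involutions n E"
  proof
    fix p assume "p \<in> partner ` {M. M \<subseteq> E \<and> disjoint M}"
    then obtain M where M: "p = partner M" "M \<subseteq> E" "disjoint M"
      by blast
    then show "p \<in> edge_involutions n E"
      using partner_permutes[OF M(3) E[OF M(2)]] partner_involution[OF M(3) E(1)[OF M(2)]]
        partner_edge[OF M(3) E(1)[OF M(2)]]
      by (auto simp: edge_involutions_def)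
  qed
  show "moved_pairs ` edge_involutions n E \<subseteq> {M. M \<subseteq> E \<and> disjoint M}"
    by (auto simp: edge_involutions_def disjoint_moved_pairs) (auto simp: moved_pairs_def)
qed

section \<open>Entries of Seidel matrices and the Leibniz expansion\<close>

text \<open>The second fact speaks of the square because a 2-cycle contributes
  \<open>S $$ (i, j) * S $$ (j, i)\<close>, which is minus that square.\<close>

lemma seidel_entry:
  assumes "S \<in> seidel_matrices n E" "i < n" "j < n"
  shows "S $$ (j, i) = - S $$ (i, j)"
    and "{i, j} \<in> E \<Longrightarrow> S $$ (i, j) * S $$ (i, j) = 1"
    and "{i, j} \<notin> E \<Longrightarrow> S $$ (i, j) = 0"
proof -
  have "S\<^sup>T $$ (i, j) = (- S) $$ (i, j)" and "S \<in> carrier_mat n n"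
    using assms(1) by (auto simp: seidel_matrices_def)
  then show "S $$ (j, i) = - S $$ (i, j)"
    using assms by auto
  have "if {i, j} \<in> E then S $$ (i, j) \<in> {1, -1} else S $$ (i, j) = 0"
    using assms unfolding seidel_matrices_def by blast
  then show "{i, j} \<in> E \<Longrightarrow> S $$ (i, j) * S $$ (i, j) = 1"
    and "{i, j} \<notin> E \<Longrightarrow> S $$ (i, j) = 0"
    by auto
qed

definition leibniz_term :: "nat \<Rightarrow> real mat \<Rightarrow> (nat \<Rightarrow> nat) \<Rightarrow> real poly" where
  "leibniz_term n S p = signof p * (\<Prod>i<n. char_poly_matrix S $$ (i, p i))"

lemma char_poly_leibniz:
  assumes "S \<in> carrier_mat n n"
  shows "char_poly S = (\<Sum>p | p permutes {..<n}. leibniz_term n S p)"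
proof -
  have "char_poly_matrix S \<in> carrier_mat n n"
    using assms by simp
  then show ?thesis
    unfolding char_poly_def leibniz_term_def
    by (simp add: det_def' atLeast0LessThan)
qed

lemma char_poly_matrix_entry:
  assumes "S \<in> carrier_mat n n" "i < n" "j < n"
  shows "char_poly_matrix S $$ (i, j) = (if i = j then [:- S $$ (i, j), 1:] else [:- S $$ (i, j):])"
  using assms by (auto simp: char_poly_matrix_def)

section \<open>Permutations that do not contribute\<close>

text \<open>Flipping the edge \<open>{a, p a}\<close> permutes the Seidel matrices and negates every
  term, so the sum equals its own negative.\<close>

lemma sum_seidel_leibniz_not_involution:
  assumes "simple_graph n E" "p permutes {..<n}" "p (p a) \<noteq> a" "{a, p a} \<in> E"
  shows "(\<Sum>S\<in>seidel_matrices n E. leibniz_term n S p) = 0"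
proof -
  define flip :: "real mat \<Rightarrow> real mat" where
    "flip S = mat n n (\<lambda>(i, j). if {i, j} = {a, p a} then - S $$ (i, j) else S $$ (i, j))" for S
  have a: "a < n" "p a < n"
    using assms(1,4) by (auto simp: simple_graph_def)
  have p: "p i < n" if "i < n" for i
    using permutes_in_image[OF assms(2)] that by auto
  have flip: "flip S \<in> seidel_matrices n E" if S: "S \<in> seidel_matrices n E" for S
  proof -
    have "flip S \<in> carrier_mat n n"
      by (simp add: flip_def)
    moreover have "(flip S)\<^sup>T = - flip S"
    proof (intro eq_matI)
      fix i j assume "i < dim_row (- flip S)" "j < dim_col (- flip S)"
      then have ij: "i < n" "j < n"
        by (auto simp: flip_def)
      then show "(flip S)\<^sup>T $$ (i, j) = (- flip S) $$ (i, j)"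
        using seidel_entry(1)[OF S ij] by (simp add: flip_def insert_commute[of j i])
    qed (auto simp: flip_def)
    moreover have "if {i, j} \<in> E then flip S $$ (i, j) \<in> {1, -1} else flip S $$ (i, j) = 0"
      if ij: "i < n" "j < n" for i j
    proof -
      have "if {i, j} \<in> E then S $$ (i, j) \<in> {1, -1} else S $$ (i, j) = 0"
        using S ij unfolding seidel_matrices_def by blast
      then show ?thesis
        using ij by (auto simp: flip_def split: if_splits)
    qed
    ultimately show ?thesis
      unfolding seidel_matrices_def by blast
  qed
  have flip_flip: "flip (flip S) = S" if "S \<in> seidel_matrices n E" for S
    using that by (intro eq_matI) (auto simp: flip_def seidel_matrices_def)
  have neg: "leibniz_term n (flip S) p = - leibniz_term n S p" if S: "S \<in> seidel_matrices n E" for S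
  proof -
    have carrier: "S \<in> carrier_mat n n" "flip S \<in> carrier_mat n n"
      using S flip[OF S] by (auto simp: seidel_matrices_def)
    have "char_poly_matrix (flip S) $$ (i, p i)
        = (if i = a then -1 else 1) * char_poly_matrix S $$ (i, p i)" if "i < n" for i
    proof -
      \<comment> \<open>The other way to obtain the same pair, \<open>i = p a\<close> with
        \<open>p i = a\<close>, is excluded by \<open>p (p a) \<noteq> a\<close>. Hence exactly one
        factor changes.\<close>
      have "{i, p i} = {a, p a} \<longleftrightarrow> i = a"
        using assms(3) by (auto simp: doubleton_eq_iff)
      then have "flip S $$ (i, p i) = (if i = a then - S $$ (i, p i) else S $$ (i, p i))"
        using that p[OF that] by (simp add: flip_def)
      \<comment> \<open>The changed factor is off the diagonal: it has no \<open>x\<close> part and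
        is negated as a whole.\<close>
      moreover have "p i = i \<Longrightarrow> i \<noteq> a"
        using assms(3) by auto
      ultimately show ?thesis
        using that p[OF that] carrier by (auto simp: char_poly_matrix_entry)
    qed
    then have "(\<Prod>i<n. char_poly_matrix (flip S) $$ (i, p i))
        = (\<Prod>i<n. if i = a then -1 else 1) * (\<Prod>i<n. char_poly_matrix S $$ (i, p i))"
      unfolding prod.distrib[symmetric] by (intro prod.cong) auto
    also have "(\<Prod>i<n. if i = a then -1 else 1 :: real poly) = -1"
      using a by simp
    finally show ?thesis
      by (simp add: leibniz_term_def)
  qed
  have "(\<Sum>S\<in>seidel_matrices n E. leibniz_term n S p)
      = (\<Sum>S\<in>seidel_matrices n E. leibniz_term n (flip S) p)"
    by (rule sum.reindex_bij_witness[of _ flip flip]) (auto simp: flip flip_flip)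
  also have "\<dots> = - (\<Sum>S\<in>seidel_matrices n E. leibniz_term n S p)"
    by (simp add: neg sum_negf)
  finally show ?thesis
    by (simp add: eq_neg_iff_add_eq_0 flip: mult_2)
qed

text \<open>A point moved along a non-edge selects a zero off-diagonal entry, so the term vanishes
  for each \<open>S\<close> without averaging.\<close>

lemma leibniz_term_non_edge:
  assumes "S \<in> seidel_matrices n E" "p permutes {..<n}" "p i \<noteq> i" "{i, p i} \<notin> E"
  shows "leibniz_term n S p = 0"
proof -
  have i: "i < n" "p i < n"
    using assms(2,3) permutes_in_image[OF assms(2), of i] by (auto simp: permutes_def)
  have "char_poly_matrix S $$ (i, p i) = 0"
    using assms i seidel_entry(3)[OF assms(1) i]
    by (simp add: char_poly_matrix_entry[of S n] seidel_matrices_def)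
  then have "(\<Prod>i<n. char_poly_matrix S $$ (i, p i)) = 0"
    using i by (intro prod_zero) auto
  then show ?thesis
    by (simp add: leibniz_term_def)
qed

section \<open>The contribution of a matching\<close>

lemma card_Union_matching:
  assumes "disjoint M" "\<forall>e\<in>M. card e = 2"
  shows "card (\<Union>M) = 2 * card M"
proof -
  have "card (\<Union>M) = sum card M"
    using assms by (intro card_Union_disjoint) (auto simp: disjoint_def pairwise_def disjnt_def intro: card_ge_0_finite)
  then show ?thesis
    using assms by simp
qed

text \<open>The product splits into fixed points and edges of \<open>M\<close>. The value does not
  depend on \<open>S\<close>, so averaging leaves it unchanged.\<close>

lemma leibniz_term_partner:
  assumes "simple_graph n E" "S \<in> seidel_matrices n E" "M \<subseteq> E" "disjoint M"
  shows "leibniz_term n S (partner M) = monom 1 (n - 2 * card M)"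
proof -
  have M2: "\<forall>e\<in>M. card e = 2" and Mn: "\<Union>M \<subseteq> {..<n}"
    using assms(1,3) by (auto simp: simple_graph_def)
  have fin: "finite M"
    using Mn by (meson finite_UnionD finite_lessThan finite_subset)
  have carrier: "S \<in> carrier_mat n n"
    using assms(2) by (simp add: seidel_matrices_def)
  let ?c = "\<lambda>i. char_poly_matrix S $$ (i, partner M i)"
  \<comment> \<open>\<open>{i, i}\<close> is a singleton and hence no edge; the diagonal entries of
    \<open>xI - S\<close> are therefore exactly \<open>x\<close>, that is
    \<open>monom 1 1\<close>.\<close>
  have entry: "S $$ (i, i) = 0" if "i < n" for i
    using seidel_entry(3)[OF assms(2) that that] assms(1) by (force simp: simple_graph_def)
  have pair: "prod ?c e = -1" if e: "e \<in> M" for e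
  proof -
    obtain a b where ab: "e = {a, b}" "a \<noteq> b"
      using e M2 by (auto simp: card_2_iff)
    then have n: "a < n" "b < n" and E: "{a, b} \<in> E"
      using e Mn assms(3) by auto
    have "partner M a = b" "partner M b = a"
      using e ab assms(4) by (auto intro!: partner_eq simp: insert_commute)
    then have "prod ?c e = [:- S $$ (a, b):] * [:- S $$ (b, a):]"
      using ab n carrier by (simp add: char_poly_matrix_entry)
    also have "\<dots> = -1"
      using seidel_entry(1,2)[OF assms(2) n] E by (simp add: one_pCons)
    finally show ?thesis .
  qed
  have "(\<Prod>i<n. ?c i) = (\<Prod>i\<in>{..<n} - \<Union>M. ?c i) * (\<Prod>i\<in>\<Union>M. ?c i)"
    using Mn by (intro prod.subset_diff) auto
  also have "(\<Prod>i\<in>{..<n} - \<Union>M. ?c i) = (\<Prod>i\<in>{..<n} - \<Union>M. monom 1 1)"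
    using carrier entry
    by (intro prod.cong) (auto simp: partner_outside char_poly_matrix_entry monom_Suc)
  also have "\<dots> = monom 1 (n - 2 * card M)"
    using card_Union_matching[OF assms(4) M2] Mn finite_subset[OF Mn]
    by (simp add: card_Diff_subset monom_power)
  also have "(\<Prod>i\<in>\<Union>M. ?c i) = (\<Prod>e\<in>M. prod ?c e)"
    using M2 assms(4)
    by (subst prod.Union_disjoint) (auto simp: disjoint_def intro: card_ge_0_finite)
  also have "\<dots> = (-1) ^ card M"
    by (simp add: pair)
  finally show ?thesis
    using sign_partner[OF fin assms(4) M2]
    by (simp add: leibniz_term_def algebra_simps flip: power_mult_distrib)
qed

section \<open>Summation over matrices and matchings\<close>

text \<open>After exchanging the sums, only edge involutions remain. Their terms are the same for
  all \<open>S\<close>, whence the factor \<open>card (seidel_matrices n E)\<close>.\<close>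

lemma sum_seidel_char_poly:
  assumes "simple_graph n E"
  shows "(\<Sum>S\<in>seidel_matrices n E. char_poly S)
    = Polynomial.smult (card (seidel_matrices n E))
        (\<Sum>M | M \<subseteq> E \<and> disjoint M. monom 1 (n - 2 * card M))"
proof -
  let ?SM = "seidel_matrices n E"
  let ?total = "\<lambda>p. \<Sum>S\<in>?SM. leibniz_term n S p"
  have "(\<Sum>S\<in>?SM. char_poly S) = (\<Sum>S\<in>?SM. \<Sum>p | p permutes {..<n}. leibniz_term n S p)"
    by (intro sum.cong char_poly_leibniz) (auto simp: seidel_matrices_def)
  also have "\<dots> = (\<Sum>p | p permutes {..<n}. ?total p)"
    by (rule sum.swap)
  also have "\<dots> = (\<Sum>p\<in>edge_involutions n E. ?total p)"
  proof (rule sum.mono_neutral_right)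
    show "\<forall>p\<in>{p. p permutes {..<n}} - edge_involutions n E. ?total p = 0"
    proof
      fix p assume p: "p \<in> {p. p permutes {..<n}} - edge_involutions n E"
      then have perm: "p permutes {..<n}"
        by simp
      show "?total p = 0"
      \<comment> \<open>If all moves follow edges, \<open>p\<close> is not an involution and the
        terms cancel in the sum over \<open>S\<close>; otherwise each term is 0 by itself.\<close>
      proof (cases "\<forall>i. p i \<noteq> i \<longrightarrow> {i, p i} \<in> E")
        case True
        then obtain a where a: "p (p a) \<noteq> a"
          using p by (auto simp: edge_involutions_def)
        then have "p a \<noteq> a"
          by auto
        with a True show ?thesis
          by (intro sum_seidel_leibniz_not_involution[OF assms perm]) auto
      next
        case False
        then show ?thesis
          using leibniz_term_non_edge[OF _ perm] by (auto intro!: sum.neutral)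
      qed
    qed
  qed (auto simp: edge_involutions_def finite_permutations)
  also have "\<dots> = (\<Sum>M | M \<subseteq> E \<and> disjoint M. ?total (partner M))"
    by (rule sum.reindex_bij_betw[OF bij_betw_partner[OF assms], symmetric])
  also have "\<dots> = Polynomial.smult (card ?SM)
      (\<Sum>M | M \<subseteq> E \<and> disjoint M. monom 1 (n - 2 * card M))"
    using leibniz_term_partner[OF assms] by (auto simp: smult_sum2 of_nat_poly intro: sum.cong)
  finally show ?thesis .
qed

text \<open>The edges of \<open>M\<close> cover \<open>2 * card M\<close> distinct vertices. The
  bound ensures that the range of \<open>k\<close> in the theorem misses no matching.\<close>

lemma card_matching_le:
  assumes "simple_graph n E" "M \<subseteq> E" "disjoint M"
  shows "card M \<le> n div 2"
proof -
  have "\<forall>e\<in>M. card e = 2" "\<Union>M \<subseteq> {..<n}"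
    using assms(1,2) by (auto simp: simple_graph_def)
  then have "2 * card M \<le> n"
    using card_Union_matching[OF assms(3)] card_mono[of "{..<n}" "\<Union>M"] by simp
  then show ?thesis
    by simp
qed

theorem theorem7p8:
  fixes n :: nat and E :: "nat set set"
  assumes "simple_graph n E"
  shows "poly_expectation (pmf_of_set (seidel_matrices n E)) char_poly =
    (\<Sum>k = 0..n div 2. monom (real (card (matchings E k))) (n - 2 * k))"
proof -
  let ?SM = "seidel_matrices n E"
  let ?MM = "{M. M \<subseteq> E \<and> disjoint M}"
  have SM: "finite ?SM" "?SM \<noteq> {}"
    using finite_seidel_matrices seidel_matrices_nonempty[OF assms] by auto
  have "E \<subseteq> Pow {..<n}"
    using assms by (auto simp: simple_graph_def)
  then have "finite E"
    by (rule finite_subset) simp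
  then have MM: "finite ?MM"
    by simp
  \<comment> \<open>Each Seidel matrix has weight \<open>1 / card ?SM\<close>, which then cancels
    the factor from \<open>sum_seidel_char_poly\<close> since \<open>?SM\<close> is finite and
    nonempty.\<close>
  have "poly_expectation (pmf_of_set ?SM) char_poly
      = Polynomial.smult (1 / card ?SM) (\<Sum>S\<in>?SM. char_poly S)"
    using SM by (simp add: poly_expectation_def smult_sum2)
  also have "\<dots> = (\<Sum>M\<in>?MM. monom 1 (n - 2 * card M))"
    using SM by (simp add: sum_seidel_char_poly[OF assms])
  \<comment> \<open>Matchings are grouped by size; within a group all monomials agree.\<close>
  also have "\<dots> = (\<Sum>k = 0..n div 2. \<Sum>M | M \<in> ?MM \<and> card M = k. monom 1 (n - 2 * card M))"
    using MM card_matching_le[OF assms] by (intro sum.group[symmetric]) auto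
  also have "\<dots> = (\<Sum>k = 0..n div 2. monom (real (card (matchings E k))) (n - 2 * k))"
  proof (rule sum.cong)
    fix k
    have "{M. M \<in> ?MM \<and> card M = k} = matchings E k"
      by (auto simp: matchings_def)
    then show "(\<Sum>M | M \<in> ?MM \<and> card M = k. monom 1 (n - 2 * card M))
        = monom (real (card (matchings E k))) (n - 2 * k)"
      by (auto simp: matchings_def of_nat_poly smult_monom)
  qed simp
  finally show ?thesis .
qed

end
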